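(* Let $G$ be a (topologically) characteristically simple topological group which is not extremely amenable. Then $G$ acts effectively on its universal minimal flow $\mathrm{M}(G)$; that is, if $t\in G$ satisfies $tx=x$ for all $x\in\mathrm{M}(G)$, then $t=e$.
   Context: A topological group is a group with a Hausdorff topology such that $(x,y)\mapsto xy^{-1}$ is continuous; $e$ is its neutral element. A flow $(G,X)$ consists of a topological group $G$ and a (nonempty) compact Hausdorff space $X$ with a jointly continuous action $G\times X\to X$, $(t,x)\mapsto tx$. A flow is minimal if every orbit $Gx$ is dense in $X$. The universal minimal flow $(G,\mathrm{M}(G))$ is the minimal flow, unique up to isomorphism, such that for every minimal flow $(G,Y)$ there is a continuous surjective $G$-equivariant map $\mathrm{M}(G)\to Y$ (its existence and uniqueness are known). $G$ is extremely amenable if $\mathrm{M}(G)$ is a single point. $\mathrm{Aut}(G)$ is the group of topological automorphisms of $G$ and $\mathrm{Aut}(G)t=\{a(t)\mid a\in\mathrm{Aut}(G)\}$. $G$ is (topologically) characteristically simple if for every $t\in G$ with $t\ne e$ the subgroup $\langle\mathrm{Aut}(G)t\rangle$ algebraically generated by $\mathrm{Aut}(G)t$ is dense in $G$. *)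

theory Defs
  imports "HOL-Analysis.Analysis" "HOL-Algebra.Group_Action" "HOL-Algebra.Generated_Groups"
begin

(* clashes with the topological closure_of *)
no_notation Congruence.eq_closure_of (\<open>closure'_of\<index>\<close>)

locale topological_group = group G for G (structure) and T +
  assumes topspace_eq_carrier: "topspace T = carrier G"
    and Hausdorff: "Hausdorff_space T"
    and continuous_mult_inv: "continuous_map (prod_topology T T) T (\<lambda>(x, y). x \<otimes> inv y)"

locale flow = topological_group G T + group_action G "topspace X" \<phi>
  for G (structure) and T and X and \<phi> +
  assumes nonempty: "topspace X \<noteq> {}"
    and compact: "compact_space X"
    and Hausdorff_phase: "Hausdorff_space X"
    and continuous_action: "continuous_map (prod_topology T X) X (\<lambda>(t, x). \<phi> t x)"

locale minimal_flow = flow +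
  assumes dense_orbit: "\<And>x. x \<in> topspace X \<Longrightarrow> X closure_of (orbit G \<phi> x) = topspace X"

definition flow_epimorphism ::
    "('g, 'r) monoid_scheme \<Rightarrow> 'x topology \<Rightarrow> ('g \<Rightarrow> 'x \<Rightarrow> 'x) \<Rightarrow>
      'y topology \<Rightarrow> ('g \<Rightarrow> 'y \<Rightarrow> 'y) \<Rightarrow> ('x \<Rightarrow> 'y) \<Rightarrow> bool" where
  "flow_epimorphism G X \<phi> Y \<psi> p \<longleftrightarrow>
     continuous_map X Y p \<and> p ` topspace X = topspace Y \<and>
     (\<forall>t\<in>carrier G. \<forall>x\<in>topspace X. p (\<phi> t x) = \<psi> t (p x))"

text \<open>
  HOL cannot quantify over the types of the phase spaces inside a definition. In a minimal flow
  an orbit, hence the image of a map from \<open>G\<close>, is dense, so the Hausdorff phase space injects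
  into the double power set of \<open>G\<close>. Up to isomorphism, all minimal flows therefore live on
  subsets of the type \<open>'g set set\<close>. The lemma \<open>universal_minimal_flow_factor\<close> below proves that
  universality for these flows implies universality for minimal flows on every type.
\<close>

definition universal_minimal_flow ::
    "('g, 'r) monoid_scheme \<Rightarrow> 'g topology \<Rightarrow> 'x topology \<Rightarrow> ('g \<Rightarrow> 'x \<Rightarrow> 'x) \<Rightarrow> bool" where
  "universal_minimal_flow G T M \<phi> \<longleftrightarrow>
     minimal_flow G T M \<phi> \<and>
     (\<forall>(Y :: 'g set set topology) \<psi>. minimal_flow G T Y \<psi> \<longrightarrow>
        (\<exists>p. flow_epimorphism G M \<phi> Y \<psi> p))"

text \<open>
  The type \<open>'g set set\<close> is again only a representative choice; see
  \<open>extremely_amenable_iff\<close> below.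
\<close>

definition extremely_amenable :: "('g, 'r) monoid_scheme \<Rightarrow> 'g topology \<Rightarrow> bool" where
  "extremely_amenable G T \<longleftrightarrow>
     (\<exists>(M :: 'g set set topology) \<phi>. universal_minimal_flow G T M \<phi> \<and> (\<exists>x. topspace M = {x}))"

definition topological_automorphisms ::
    "('g, 'r) monoid_scheme \<Rightarrow> 'g topology \<Rightarrow> ('g \<Rightarrow> 'g) set" where
  "topological_automorphisms G T = {a \<in> iso G G. homeomorphic_map T T a}"

definition characteristically_simple :: "('g, 'r) monoid_scheme \<Rightarrow> 'g topology \<Rightarrow> bool" where
  "characteristically_simple G T \<longleftrightarrow>
     (\<forall>t\<in>carrier G. t \<noteq> \<one>\<^bsub>G\<^esub> \<longrightarrow>
        T closure_of (generate G {a t |a. a \<in> topological_automorphisms G T}) = carrier G)"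

lemma (in minimal_flow) isomorphic_copy:
  fixes f :: "'c \<Rightarrow> 'z"
  assumes inj: "inj_on f (topspace X)"
  shows "\<exists>(Y :: 'z topology) \<psi>. minimal_flow G T Y \<psi> \<and> homeomorphic_map X Y f \<and>
           (\<forall>t\<in>carrier G. \<forall>x\<in>topspace X. f (\<phi> t x) = \<psi> t (f x))"
proof -
  define S where "S = topspace X"
  define g where "g = inv_into S f"
  define Y where "Y = pullback_topology (f ` S) g X"
  define \<psi> where "\<psi> = (\<lambda>t. \<lambda>z\<in>f ` S. f (\<phi> t (g z)))"
  have gf: "g (f x) = x" if "x \<in> S" for x
    using inj that by (simp add: g_def S_def)
  have tY: "topspace Y = f ` S"
    using gf by (auto simp: Y_def topspace_pullback_topology S_def)
  have cg: "continuous_map Y X g"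
    using continuous_map_pullback[OF continuous_map_id, where A = "f ` S" and f = g]
    by (simp add: Y_def)
  have cf: "continuous_map X Y f"
    unfolding Y_def
  proof (rule continuous_map_pullback')
    show "continuous_map X X (g \<circ> f)"
      by (rule continuous_map_eq[OF continuous_map_id]) (simp add: gf S_def)
  qed (auto simp: S_def)
  have hm: "homeomorphic_maps X Y f g"
    using cf cg gf tY by (auto simp: homeomorphic_maps_def S_def)
  then have hom: "homeomorphic_map X Y f"
    using homeomorphic_maps_map by blast
  then have homs: "X homeomorphic_space Y"
    using hm homeomorphic_space_def by blast
  have mem: "\<phi> t x \<in> S" if "t \<in> carrier G" "x \<in> S" for t x
    using element_image that by (auto simp: S_def)
  have \<psi>f: "\<psi> t (f x) = f (\<phi> t x)" if "x \<in> S" for t x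
    using that by (simp add: \<psi>_def gf)
  have bij: "\<psi> t \<in> Bij (f ` S)" if t: "t \<in> carrier G" for t
  proof -
    have "inj_on (\<psi> t) (f ` S)"
    proof (rule inj_onI)
      fix y z assume "y \<in> f ` S" "z \<in> f ` S" and eq: "\<psi> t y = \<psi> t z"
      then obtain a b where ab: "y = f a" "z = f b" "a \<in> S" "b \<in> S" by blast
      then have "\<phi> t a = \<phi> t b"
        using eq inj mem[OF t] by (metis S_def \<psi>f inj_onD)
      then show "y = z"
        using ab inj_prop[OF t] by (metis S_def inj_onD)
    qed
    moreover have "\<psi> t ` f ` S = f ` S"
    proof -
      have "\<psi> t ` f ` S = f ` \<phi> t ` S"
        by (simp add: image_image \<psi>f)
      then show ?thesis
        using surj_prop[OF t] by (simp add: S_def)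
    qed
    ultimately show ?thesis
      by (simp add: Bij_def bij_betw_def \<psi>_def)
  qed
  have ga: "group_action G (topspace Y) \<psi>"
    unfolding tY
  proof (intro group_action.intro group_hom.intro group_hom_axioms.intro homI)
    show "group (BijGroup (f ` S))" by (rule group_BijGroup)
    show "\<psi> t \<in> carrier (BijGroup (f ` S))" if "t \<in> carrier G" for t
      using bij[OF that] by (simp add: BijGroup_def)
    show "\<psi> (s \<otimes> t) = \<psi> s \<otimes>\<^bsub>BijGroup (f ` S)\<^esub> \<psi> t" if "s \<in> carrier G" "t \<in> carrier G" for s t
    proof -
      have "\<psi> (s \<otimes> t) z = compose (f ` S) (\<psi> s) (\<psi> t) z" for z
      proof (cases "z \<in> f ` S")
        case True
        then obtain x where "z = f x" "x \<in> S" by blast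
        then show ?thesis
          using that composition_rule mem by (simp add: \<psi>f compose_def S_def)
      qed (simp add: \<psi>_def compose_def)
      then show ?thesis
        using bij that by (auto simp: BijGroup_def)
    qed
  qed (rule is_group)
  have cact: "continuous_map (prod_topology T Y) Y (\<lambda>(t, z). \<psi> t z)"
  proof -
    have "continuous_map (prod_topology T Y) (prod_topology T X) (\<lambda>p. (fst p, g (snd p)))"
      using continuous_map_compose[OF continuous_map_snd cg]
      by (intro continuous_map_pairedI continuous_map_fst) (simp add: o_def)
    from continuous_map_compose[OF continuous_map_compose[OF this continuous_action] cf]
    show ?thesis
      by (rule continuous_map_eq) (auto simp: \<psi>_def tY)
  qed
  have dense: "Y closure_of (orbit G \<psi> y) = topspace Y" if y: "y \<in> topspace Y" for y
  proof -
    obtain x where x: "y = f x" "x \<in> S" using y tY by blast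
    have "orbit G \<psi> y = (\<lambda>t. f (\<phi> t x)) ` carrier G"
      unfolding orbit_def x(1) \<psi>f[OF x(2)] by blast
    also have "\<dots> = f ` orbit G \<phi> x"
      unfolding orbit_def by blast
    finally have "orbit G \<psi> y = f ` orbit G \<phi> x" .
    moreover have "orbit G \<phi> x \<subseteq> topspace X"
      using mem x by (auto simp: orbit_def S_def)
    ultimately have "Y closure_of (orbit G \<psi> y) = f ` (X closure_of (orbit G \<phi> x))"
      using homeomorphic_map_closure_of[OF hom] by simp
    then show ?thesis
      using dense_orbit x tY by (simp add: S_def)
  qed
  have "minimal_flow G T Y \<psi>"
  proof (intro minimal_flow.intro flow.intro flow_axioms.intro minimal_flow_axioms.intro)
    show "topological_group G T" by (rule topological_group_axioms)
    show "topspace Y \<noteq> {}" using nonempty tY by (simp add: S_def)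
    show "compact_space Y" using compact homs homeomorphic_compact_space by blast
    show "Hausdorff_space Y" using Hausdorff_phase homs homeomorphic_Hausdorff_space by blast
    show "group_action G (topspace Y) \<psi>" by (rule ga)
    show "continuous_map (prod_topology T Y) Y (\<lambda>(t, z). \<psi> t z)" by (rule cact)
    show "Y closure_of (orbit G \<psi> y) = topspace Y" if "y \<in> topspace Y" for y
      by (rule dense[OF that])
  qed
  then show ?thesis
    using hom \<psi>f by (intro exI[of _ Y] exI[of _ \<psi>]) (simp add: S_def)
qed

lemma (in minimal_flow) inj_into_double_powerset:
  "\<exists>f :: 'c \<Rightarrow> 'a set set. inj_on f (topspace X)"
proof -
  obtain x where x: "x \<in> topspace X" using nonempty by blast
  define f where "f = (\<lambda>y. {A. A \<subseteq> carrier G \<and> y \<in> X closure_of ((\<lambda>t. \<phi> t x) ` A)})"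
  have "inj_on f (topspace X)"
  proof (rule inj_onI, rule ccontr)
    fix y z assume yz: "y \<in> topspace X" "z \<in> topspace X" "f y = f z" "y \<noteq> z"
    then obtain U V where UV: "openin X U" "openin X V" "y \<in> U" "z \<in> V" "disjnt U V"
      using Hausdorff_phase unfolding Hausdorff_space_def by metis
    define A where "A = {t \<in> carrier G. \<phi> t x \<in> U}"
    have im: "(\<lambda>t. \<phi> t x) ` A = U \<inter> orbit G \<phi> x"
      by (auto simp: A_def orbit_def)
    have "y \<in> X closure_of (U \<inter> orbit G \<phi> x)"
      using openin_Int_closure_of_subset[OF UV(1), of "orbit G \<phi> x"] dense_orbit[OF x] UV(3) yz(1)
      by auto
    then have "A \<in> f y" by (simp add: f_def im) (simp add: A_def)
    then have "A \<in> f z"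
      by (simp add: yz(3))
    then have "z \<in> X closure_of (U \<inter> orbit G \<phi> x)"
      by (simp add: f_def im)
    then have "V \<inter> U \<noteq> {}"
      using UV(2,4) unfolding in_closure_of by blast
    then show False using UV(5) by (auto simp: disjnt_def)
  qed
  then show ?thesis by blast
qed

lemma universal_minimal_flow_factor:
  fixes G :: "('g, 'r) monoid_scheme" and M :: "'x topology" and Y :: "'y topology"
  assumes M: "universal_minimal_flow G T M \<phi>" and Y: "minimal_flow G T Y \<psi>"
  shows "\<exists>p. flow_epimorphism G M \<phi> Y \<psi> p"
proof -
  interpret Y: minimal_flow G T Y \<psi> by (rule Y)
  interpret M: minimal_flow G T M \<phi> using M by (simp add: universal_minimal_flow_def)
  obtain f :: "'y \<Rightarrow> 'g set set" where "inj_on f (topspace Y)"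
    using Y.inj_into_double_powerset by blast
  then obtain Z \<xi> where Z: "minimal_flow G T Z \<xi>" and f: "homeomorphic_map Y Z f"
      and eq: "\<And>t y. t \<in> carrier G \<Longrightarrow> y \<in> topspace Y \<Longrightarrow> f (\<psi> t y) = \<xi> t (f y)"
    using Y.isomorphic_copy by metis
  obtain q where q: "flow_epimorphism G M \<phi> Z \<xi> q"
    using M Z by (auto simp: universal_minimal_flow_def)
  obtain g where g: "homeomorphic_maps Y Z f g"
    using f homeomorphic_map_maps by blast
  have cg: "continuous_map Z Y g"
    and gf: "\<And>y. y \<in> topspace Y \<Longrightarrow> g (f y) = y"
    and fg: "\<And>z. z \<in> topspace Z \<Longrightarrow> f (g z) = z"
    using g by (simp_all add: homeomorphic_maps_def)
  have "homeomorphic_map Z Y g"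
    using g homeomorphic_maps_map by blast
  then have img: "g ` topspace Z = topspace Y"
    by (rule homeomorphic_imp_surjective_map)
  have equiv: "g (\<xi> t z) = \<psi> t (g z)" if t: "t \<in> carrier G" and z: "z \<in> topspace Z" for t z
  proof -
    have gz: "g z \<in> topspace Y"
      using z img by blast
    then have "\<psi> t (g z) \<in> topspace Y"
      using Y.element_image t by blast
    then have "g (f (\<psi> t (g z))) = \<psi> t (g z)"
      by (rule gf)
    then show ?thesis
      by (simp only: eq[OF t gz] fg[OF z])
  qed
  have cq: "continuous_map M Z q" and imq: "q ` topspace M = topspace Z"
    and eqq: "\<And>t x. t \<in> carrier G \<Longrightarrow> x \<in> topspace M \<Longrightarrow> q (\<phi> t x) = \<xi> t (q x)"
    using q by (simp_all add: flow_epimorphism_def)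
  have "flow_epimorphism G M \<phi> Y \<psi> (g \<circ> q)"
    unfolding flow_epimorphism_def
  proof (intro conjI ballI)
    show "continuous_map M Y (g \<circ> q)" using cq cg by (rule continuous_map_compose)
    show "(g \<circ> q) ` topspace M = topspace Y" by (simp only: image_comp[symmetric] imq img)
    show "(g \<circ> q) (\<phi> t x) = \<psi> t ((g \<circ> q) x)" if "t \<in> carrier G" "x \<in> topspace M" for t x
    proof -
      have "q x \<in> topspace Z" using that(2) imq by blast
      then show ?thesis using that by (simp add: eqq equiv)
    qed
  qed
  then show ?thesis by blast
qed

lemma extremely_amenable_iff:
  fixes G :: "('g, 'r) monoid_scheme" and M :: "'x topology"
  assumes M: "universal_minimal_flow G T M \<phi>"
  shows "extremely_amenable G T \<longleftrightarrow> (\<exists>x. topspace M = {x})"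
proof
  assume "extremely_amenable G T"
  then obtain N :: "'g set set topology" and \<psi> x where
    N: "universal_minimal_flow G T N \<psi>" "topspace N = {x}"
    by (auto simp: extremely_amenable_def)
  have "minimal_flow G T M \<phi>" using M by (simp add: universal_minimal_flow_def)
  then obtain p where "flow_epimorphism G N \<psi> M \<phi> p"
    using universal_minimal_flow_factor[OF N(1)] by blast
  then have "topspace M = {p x}" using N(2) by (auto simp: flow_epimorphism_def)
  then show "\<exists>x. topspace M = {x}" by blast
next
  assume "\<exists>x. topspace M = {x}"
  then obtain x where x: "topspace M = {x}" by blast
  interpret M: minimal_flow G T M \<phi> using M by (simp add: universal_minimal_flow_def)
  define f where "f = (\<lambda>_ :: 'x. {} :: 'g set set)"
  have "inj_on f (topspace M)" using x by simp
  then obtain N \<psi> where N: "minimal_flow G T N \<psi>" and f: "homeomorphic_map M N f"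
      and eq: "\<And>t y. t \<in> carrier G \<Longrightarrow> y \<in> topspace M \<Longrightarrow> f (\<phi> t y) = \<psi> t (f y)"
    using M.isomorphic_copy by metis
  interpret N: minimal_flow G T N \<psi> by (rule N)
  have tN: "topspace N = {f x}"
    using homeomorphic_imp_surjective_map[OF f] x by simp
  have "\<exists>p. flow_epimorphism G N \<psi> Y \<xi> p"
    if Y: "minimal_flow G T Y \<xi>" for Y :: "'g set set topology" and \<xi>
  proof -
    interpret Y: minimal_flow G T Y \<xi> by (rule Y)
    obtain q where q: "flow_epimorphism G M \<phi> Y \<xi> q"
      using M Y by (auto simp: universal_minimal_flow_def)
    then have tY: "topspace Y = {q x}" using x by (auto simp: flow_epimorphism_def)
    have "\<xi> t (q x) = q x" if "t \<in> carrier G" for t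
      using Y.element_image[OF that, of "q x"] tY by blast
    then have "flow_epimorphism G N \<psi> Y \<xi> (\<lambda>_. q x)"
      using tY tN by (simp add: flow_epimorphism_def)
    then show ?thesis by blast
  qed
  then have "universal_minimal_flow G T N \<psi>"
    using N by (auto simp: universal_minimal_flow_def)
  then show "extremely_amenable G T" using tN by (auto simp: extremely_amenable_def)
qed

end

theory Submission
  imports Defs
begin

text \<open>
  Twisting the action on \<open>M(G)\<close> by a topological automorphism \<open>a\<close> gives another minimal flow,
  onto which \<open>M(G)\<close> therefore maps. Hence the kernel of the action is invariant under \<open>a\<close>. This
  kernel is a closed subgroup, so if it is nontrivial it is all of \<open>G\<close>, and then density of
  orbits leaves only one point in \<open>M(G)\<close>.
\<close>

lemma (in minimal_flow) twisted_minimal_flow: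
  assumes a: "a \<in> topological_automorphisms G T"
  shows "minimal_flow G T X (\<phi> \<circ> a)"
proof (intro minimal_flow.intro flow.intro flow_axioms.intro minimal_flow_axioms.intro)
  have iso: "a \<in> iso G G" and hom: "homeomorphic_map T T a"
    using a by (auto simp: topological_automorphisms_def)
  have img: "a ` carrier G = carrier G"
    using iso by (auto simp: iso_def bij_betw_def)
  have "a \<in> hom G G" and "\<phi> \<in> hom G (BijGroup (topspace X))"
    using iso group_hom group_hom.homh by (auto simp: iso_def)
  then have "\<phi> \<circ> a \<in> hom G (BijGroup (topspace X))"
    by (rule Group.hom_compose)
  then show "group_action G (topspace X) (\<phi> \<circ> a)"
    by (intro group_action.intro group_hom.intro group_hom_axioms.intro is_group group_BijGroup)
  have "continuous_map (prod_topology T X) (prod_topology T X) (\<lambda>p. (a (fst p), snd p))"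
    using continuous_map_compose[OF continuous_map_fst homeomorphic_imp_continuous_map[OF hom]]
    by (intro continuous_map_pairedI continuous_map_snd) (simp add: o_def)
  from continuous_map_compose[OF this continuous_action]
  show "continuous_map (prod_topology T X) X (\<lambda>(t, x). (\<phi> \<circ> a) t x)"
    by (simp add: o_def case_prod_unfold)
  show "X closure_of (orbit G (\<phi> \<circ> a) x) = topspace X" if "x \<in> topspace X" for x
  proof -
    \<comment> \<open>As \<open>a\<close> is onto, the twist only relabels group elements: each
      orbit is unchanged as a set, so its density is inherited.\<close>
    have "orbit G (\<phi> \<circ> a) x = (\<lambda>t. \<phi> t x) ` a ` carrier G"
      by (auto simp: orbit_def)
    also have "\<dots> = orbit G \<phi> x"
      unfolding img by (auto simp: orbit_def)
    finally show ?thesis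
      using dense_orbit[OF that] by simp
  qed
qed (rule topological_group_axioms nonempty compact Hausdorff_phase)+

text \<open>Points of a Hausdorff space are closed, so each stabilizer is the preimage of a closed
  set under a continuous orbit map; the kernel is the intersection of all stabilizers.\<close>

lemma (in flow) closedin_fixator:
  "closedin T {t \<in> carrier G. \<forall>x\<in>topspace X. \<phi> t x = x}"
proof -
  have "closedin T {t \<in> topspace T. \<phi> t x \<in> {x}}" if x: "x \<in> topspace X" for x
  proof (rule closedin_continuous_map_preimage)
    have "continuous_map T (prod_topology T X) (\<lambda>t. (t, x))"
      using x by (intro continuous_map_pairedI) simp_all
    from continuous_map_compose[OF this continuous_action]
    show "continuous_map T X (\<lambda>t. \<phi> t x)"
      by (simp add: o_def)
    show "closedin X {x}"
      using x Hausdorff_phase by (simp add: closedin_Hausdorff_singleton)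
  qed
  \<comment> \<open>Nonemptiness of the phase space matters here: an empty intersection would be the
    whole type instead of \<open>carrier G\<close>.\<close>
  then have "closedin T (\<Inter>x\<in>topspace X. {t \<in> topspace T. \<phi> t x \<in> {x}})"
    using nonempty by (intro closedin_Inter) auto
  moreover have "(\<Inter>x\<in>topspace X. {t \<in> topspace T. \<phi> t x \<in> {x}})
      = {t \<in> carrier G. \<forall>x\<in>topspace X. \<phi> t x = x}"
    using nonempty topspace_eq_carrier by auto
  ultimately show ?thesis by simp
qed

lemma (in group_action) subgroup_fixator:
  "subgroup {t \<in> carrier G. \<forall>x\<in>E. \<phi> t x = x} G"
proof -
  interpret group G
    using group_hom group_hom.axioms(1) by blast
  show ?thesis
  proof (rule subgroupI)
    have "\<phi> \<one> x = x" if "x \<in> E" for x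
      using id_eq_one that by (metis restrict_apply')
    then show "{t \<in> carrier G. \<forall>x\<in>E. \<phi> t x = x} \<noteq> {}"
      by blast
  \<comment> \<open>Inverses: \<open>orbit_sym_aux\<close> turns \<open>\<phi> t x = x\<close> into
    \<open>\<phi> (inv t) x = x\<close>.\<close>
  qed (auto simp: composition_rule orbit_sym_aux)
qed

text \<open>Let \<open>p\<close> map the flow onto its twist by \<open>a\<close>. Every point is
  some \<open>p y\<close>, and equivariance gives
  \<open>\<phi> (a t) (p y) = p (\<phi> t y) = p y\<close>.\<close>

lemma automorphism_acts_trivially:
  assumes M: "universal_minimal_flow G T M \<phi>"
    and a: "a \<in> topological_automorphisms G T"
    and t: "t \<in> carrier G" "\<And>x. x \<in> topspace M \<Longrightarrow> \<phi> t x = x"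
    and x: "x \<in> topspace M"
  shows "\<phi> (a t) x = x"
proof -
  interpret minimal_flow G T M \<phi>
    using M by (simp add: universal_minimal_flow_def)
  obtain p where p: "flow_epimorphism G M \<phi> M (\<phi> \<circ> a) p"
    using universal_minimal_flow_factor[OF M twisted_minimal_flow[OF a]] by blast
  then obtain y where y: "y \<in> topspace M" "x = p y"
    using x unfolding flow_epimorphism_def by blast
  have "p (\<phi> t y) = \<phi> (a t) (p y)"
    using p t(1) y(1) by (simp add: flow_epimorphism_def)
  then show ?thesis
    using t(2) y by simp
qed

text \<open>Each orbit is then a single point, which is closed by the Hausdorff property and dense
  by minimality.\<close>

lemma (in minimal_flow) trivial_action_imp_singleton:
  assumes "\<And>t x. t \<in> carrier G \<Longrightarrow> x \<in> topspace X \<Longrightarrow> \<phi> t x = x"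
  shows "\<exists>x. topspace X = {x}"
proof -
  obtain x where x: "x \<in> topspace X"
    using nonempty by blast
  have "orbit G \<phi> x \<subseteq> {x}"
    using assms x unfolding orbit_def by blast
  moreover have "x \<in> orbit G \<phi> x"
    using orbit_refl x by blast
  ultimately have "orbit G \<phi> x = {x}" by blast
  then have "topspace X = {x}"
    using dense_orbit[OF x] closure_of_closedin[OF closedin_Hausdorff_singleton[OF Hausdorff_phase x]]
    by simp
  then show ?thesis by blast
qed

theorem corollary2p2:
  fixes G :: "('g, 'r) monoid_scheme" and T :: "'g topology"
    and M :: "'x topology" and \<phi> :: "'g \<Rightarrow> 'x \<Rightarrow> 'x"
  assumes "topological_group G T"
    and "characteristically_simple G T"
    and "\<not> extremely_amenable G T"
    and "universal_minimal_flow G T M \<phi>"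
  shows "\<forall>t\<in>carrier G. (\<forall>x\<in>topspace M. \<phi> t x = x) \<longrightarrow> t = \<one>\<^bsub>G\<^esub>"
proof (intro ballI impI, rule ccontr)
  fix t assume t: "t \<in> carrier G" "\<forall>x\<in>topspace M. \<phi> t x = x" "t \<noteq> \<one>\<^bsub>G\<^esub>"
  interpret minimal_flow G T M \<phi>
    using assms(4) by (simp add: universal_minimal_flow_def)
  \<comment> \<open>\<open>K\<close> is the kernel of the action. Being a closed subgroup, it
    contains the closure of whatever subgroup its elements generate.\<close>
  define K where "K = {t \<in> carrier G. \<forall>x\<in>topspace M. \<phi> t x = x}"
  have "{a t |a. a \<in> topological_automorphisms G T} \<subseteq> K"
  proof clarify
    fix a assume a: "a \<in> topological_automorphisms G T"
    then have "a t \<in> carrier G"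
      using t(1) by (auto simp: topological_automorphisms_def iso_def hom_def)
    then show "a t \<in> K"
      using automorphism_acts_trivially[OF assms(4) a t(1)] t(2) by (simp add: K_def)
  qed
  then have "generate G {a t |a. a \<in> topological_automorphisms G T} \<subseteq> K"
    using generate_subgroup_incl subgroup_fixator by (simp add: K_def)
  then have "T closure_of (generate G {a t |a. a \<in> topological_automorphisms G T}) \<subseteq> K"
    using closedin_fixator by (intro closure_of_minimal) (simp_all add: K_def)
  \<comment> \<open>Characteristic simplicity, applied to \<open>t\<close>, says that the closure
    just bounded is all of \<open>G\<close>.\<close>
  then have "carrier G \<subseteq> K"
    using assms(2) t(1,3) by (simp add: characteristically_simple_def)
  then have "\<exists>x. topspace M = {x}"
    by (intro trivial_action_imp_singleton) (auto simp: K_def)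
  \<comment> \<open>\<open>M\<close> may live on any type, whereas \<open>extremely_amenable\<close>
    speaks of a model on \<open>'g set set\<close>; the equivalence bridges the two.\<close>
  then show False
    using assms(3) extremely_amenable_iff[OF assms(4)] by simp
qed

end
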